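(* For every diameter bound $\ell>0$ there exists a $(\Gamma,d+1)$-hash $\varphi:\mathbb{R}^d\to\mathbb{R}^d$ with diameter bound $\ell$, for $\Gamma=\Theta(d\sqrt d)$. Furthermore, $\varphi$ is determined solely by $d$ and the diameter bound $\ell$, and one can evaluate $\varphi(x)$ for an input $x\in\mathbb{R}^d$ in time and space $\mathrm{poly}(d)$.
   Context: A mapping $\varphi:\mathbb{R}^d\to\mathbb{R}^d$ is a $(\Gamma,\Lambda)$-hash with diameter bound $\ell>0$ if (1) for every $z\in\varphi(\mathbb{R}^d)$, the Euclidean diameter of $\varphi^{-1}(z)$ is at most $\ell$, and (2) every $S\subseteq\mathbb{R}^d$ of Euclidean diameter at most $\ell/\Gamma$ satisfies $|\varphi(S)|\le\Lambda$. *)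

theory Defs
  imports
    "HOL-Analysis.Analysis"
    "HOL-Library.Landau_Symbols"
    "HOL-Computational_Algebra.Polynomial"
begin

text \<open>
  The dimension varies inside the statements, so \<open>\<real>\<^sup>d\<close> is
  \<^term>\<open>topspace (Euclidean_space d)\<close>, the functions \<^typ>\<open>nat \<Rightarrow> real\<close> that vanish
  from index \<^term>\<open>d\<close> on.
\<close>

definition eucl_dist :: "nat \<Rightarrow> (nat \<Rightarrow> real) \<Rightarrow> (nat \<Rightarrow> real) \<Rightarrow> real" where
  "eucl_dist d x y = L2_set (\<lambda>i. x i - y i) {..<d}"

text \<open>The diameter is an extended real, so that an unbounded set has diameter \<open>\<infinity>\<close>.\<close>

definition eucl_diam :: "nat \<Rightarrow> (nat \<Rightarrow> real) set \<Rightarrow> ennreal" where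
  "eucl_diam d S = (SUP x\<in>S. SUP y\<in>S. ennreal (eucl_dist d x y))"

definition is_hash ::
  "nat \<Rightarrow> real \<Rightarrow> nat \<Rightarrow> real \<Rightarrow> ((nat \<Rightarrow> real) \<Rightarrow> (nat \<Rightarrow> real)) \<Rightarrow> bool" where
  "is_hash d \<Gamma> \<Lambda> l \<phi> \<longleftrightarrow>
     0 < \<Gamma> \<and> 0 < l \<and>
     \<phi> \<in> topspace (Euclidean_space d) \<rightarrow> topspace (Euclidean_space d) \<and>
     (\<forall>z \<in> \<phi> ` topspace (Euclidean_space d).
        eucl_diam d {x \<in> topspace (Euclidean_space d). \<phi> x = z} \<le> ennreal l) \<and>
     (\<forall>S \<subseteq> topspace (Euclidean_space d).
        eucl_diam d S \<le> ennreal (l / \<Gamma>) \<longrightarrow> finite (\<phi> ` S) \<and> card (\<phi> ` S) \<le> \<Lambda>)"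

text \<open>
  Running time and space refer to a real RAM with unit-cost arithmetic, comparisons and
  floor. It has registers, addressed directly by the program text, and a memory, addressed
  indirectly through the contents of a register. A program is one fixed finite list of
  instructions with integer constants; the dimension and the diameter bound are inputs of it.
\<close>

datatype instr =
    Const nat int
  | Add nat nat nat
  | Sub nat nat nat
  | Mul nat nat nat
  | Div nat nat nat
  | Floor nat nat
  | Load nat nat
  | Store nat nat
  | JumpLe nat nat nat

type_synonym regs = "nat \<Rightarrow> real"
type_synonym memory = "nat \<Rightarrow> real"
type_synonym config = "nat \<times> regs \<times> memory"

definition addr :: "real \<Rightarrow> nat" where
  "addr a = nat \<lfloor>a\<rfloor>"

text \<open>
  In each instruction the first argument is the target; in \<^term>\<open>Store i j\<close> register
  \<^term>\<open>i\<close> holds the target address. Division by \<open>0\<close> gives \<open>0\<close>, as always in HOL.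
\<close>

fun exec_instr :: "instr \<Rightarrow> config \<Rightarrow> config" where
  "exec_instr (Const i c) (pc, r, m) = (Suc pc, r(i := of_int c), m)"
| "exec_instr (Add i j k) (pc, r, m) = (Suc pc, r(i := r j + r k), m)"
| "exec_instr (Sub i j k) (pc, r, m) = (Suc pc, r(i := r j - r k), m)"
| "exec_instr (Mul i j k) (pc, r, m) = (Suc pc, r(i := r j * r k), m)"
| "exec_instr (Div i j k) (pc, r, m) = (Suc pc, r(i := r j / r k), m)"
| "exec_instr (Floor i j) (pc, r, m) = (Suc pc, r(i := of_int \<lfloor>r j\<rfloor>), m)"
| "exec_instr (Load i j) (pc, r, m) = (Suc pc, r(i := m (addr (r j))), m)"
| "exec_instr (Store i j) (pc, r, m) = (Suc pc, r, m(addr (r i) := r j))"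
| "exec_instr (JumpLe l i j) (pc, r, m) = (if r i \<le> r j then l else Suc pc, r, m)"

fun regs_used :: "instr \<Rightarrow> nat set" where
  "regs_used (Const i c) = {i}"
| "regs_used (Add i j k) = {i, j, k}"
| "regs_used (Sub i j k) = {i, j, k}"
| "regs_used (Mul i j k) = {i, j, k}"
| "regs_used (Div i j k) = {i, j, k}"
| "regs_used (Floor i j) = {i, j}"
| "regs_used (Load i j) = {i, j}"
| "regs_used (Store i j) = {i, j}"
| "regs_used (JumpLe l i j) = {i, j}"

fun mem_used :: "instr \<Rightarrow> regs \<Rightarrow> nat set" where
  "mem_used (Load i j) r = {addr (r j)}"
| "mem_used (Store i j) r = {addr (r i)}"
| "mem_used _ r = {}"

definition halted :: "instr list \<Rightarrow> config \<Rightarrow> bool" where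
  "halted P c \<longleftrightarrow> fst c \<ge> length P"

definition step :: "instr list \<Rightarrow> config \<Rightarrow> config" where
  "step P c = (if halted P c then c else exec_instr (P ! fst c) c)"

definition within_space :: "instr list \<Rightarrow> nat \<Rightarrow> config \<Rightarrow> bool" where
  "within_space P s c \<longleftrightarrow>
     (\<not> halted P c \<longrightarrow>
        regs_used (P ! fst c) \<union> mem_used (P ! fst c) (fst (snd c)) \<subseteq> {..<s})"

definition init_config :: "nat \<Rightarrow> real \<Rightarrow> (nat \<Rightarrow> real) \<Rightarrow> config" where
  "init_config d l x = (0, (\<lambda>_. 0)(0 := real d, 1 := l), x)"

text \<open>
  On every input \<open>(d, l, x)\<close> with \<open>x \<in> \<real>\<^sup>d\<close>, program \<open>P\<close> halts after at most \<open>t\<close> steps with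
  \<open>\<phi> x\<close> in the first \<open>d\<close> memory cells, touching only the first \<open>s\<close> registers and the first
  \<open>s\<close> memory cells.
\<close>

definition evaluates_within ::
  "instr list \<Rightarrow> nat \<Rightarrow> real \<Rightarrow> ((nat \<Rightarrow> real) \<Rightarrow> (nat \<Rightarrow> real)) \<Rightarrow> nat \<Rightarrow> nat \<Rightarrow> bool" where
  "evaluates_within P d l \<phi> t s \<longleftrightarrow>
     (\<forall>x \<in> topspace (Euclidean_space d). \<exists>n \<le> t.
        halted P ((step P ^^ n) (init_config d l x)) \<and>
        (\<forall>i<d. snd (snd ((step P ^^ n) (init_config d l x))) i = \<phi> x i) \<and>
        (\<forall>k<n. within_space P s ((step P ^^ k) (init_config d l x))))"

end

theory Submission
  imports Defs
begin

text \<open>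
  Rescale so that the lattice cubes have side 1 and diameter at most the bound \<open>l\<close>, and put
  \<open>\<epsilon> = 1 / (2d + 3)\<close>. Let the level of a point be the least \<open>m\<close> such that at most \<open>m\<close>
  coordinates are within \<open>(m + 1)\<epsilon>\<close> of an integer. By minimality at least \<open>m\<close> coordinates are
  within \<open>m\<epsilon>\<close> of an integer, so no coordinate has a distance in \<open>(m\<epsilon>, (m + 1)\<epsilon>]\<close>. Round the
  coordinates within \<open>m\<epsilon>\<close> of an integer to that integer, and the others to the open unit
  interval containing them. Because of the gap, two points of the same level at distance at most
  \<open>\<epsilon>\<close> are rounded alike, so a set of diameter \<open>\<epsilon>\<close> gets at most one value for each of the
  \<open>d + 1\<close> levels. The machine has no square root, so the scale uses the least integer
  \<open>s\<close> with \<open>d \<le> s\<^sup>2\<close> in place of \<open>\<surd>d\<close>.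
\<close>

section \<open>Nearness to integers and rounding of a single coordinate\<close>

section \<open>The hash\<close>

text \<open>Since \<open>- \<lfloor>t - u\<rfloor>\<close> is the ceiling of u - t, for t \<ge> 0
  this counts the integers in [u - t, u + t]. For t < 1/2 it is a 0/1 indicator that needs only
  arithmetic and floor.\<close>

definition near_ind :: "real \<Rightarrow> real \<Rightarrow> int" where
  "near_ind u t = \<lfloor>u + t\<rfloor> + \<lfloor>t - u\<rfloor> + 1"

definition near :: "real \<Rightarrow> real \<Rightarrow> bool" where
  "near u t \<longleftrightarrow> (\<exists>n::int. \<bar>u - of_int n\<bar> \<le> t)"

lemma near_mono: "near u t \<Longrightarrow> t \<le> t' \<Longrightarrow> near u t'"
  unfolding near_def by (meson order_trans)

lemma near_perturb: "near u t \<Longrightarrow> \<bar>u - v\<bar> \<le> e \<Longrightarrow> near v (t + e)"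
proof -
  assume "near u t" and uv: "\<bar>u - v\<bar> \<le> e"
  then obtain n :: int where "\<bar>u - of_int n\<bar> \<le> t" unfolding near_def by blast
  with uv have "\<bar>v - of_int n\<bar> \<le> t + e" by linarith
  then show "near v (t + e)" unfolding near_def by blast
qed

lemma near_ind_cases:
  assumes "0 \<le> t" "t < 1/2"
  shows "near_ind u t = 0 \<or> near_ind u t = 1"
proof -
  have "of_int \<lfloor>u + t\<rfloor> \<le> u + t" "u + t < of_int \<lfloor>u + t\<rfloor> + 1"
    "of_int \<lfloor>t - u\<rfloor> \<le> t - u" "t - u < of_int \<lfloor>t - u\<rfloor> + 1"
    by linarith+
  then have "real_of_int (\<lfloor>u + t\<rfloor> + \<lfloor>t - u\<rfloor>) < 1" "real_of_int (\<lfloor>u + t\<rfloor> + \<lfloor>t - u\<rfloor>) > -2"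
    using assms unfolding of_int_add by linarith+
  then have "\<lfloor>u + t\<rfloor> + \<lfloor>t - u\<rfloor> < 1" "\<lfloor>u + t\<rfloor> + \<lfloor>t - u\<rfloor> > -2" by linarith+
  then show ?thesis unfolding near_ind_def by linarith
qed

lemma near_ind_eq:
  assumes "0 \<le> t" "t < 1/2"
  shows "near_ind u t = of_bool (near u t)"
proof (cases "near u t")
  case True
  then obtain n :: int where n: "\<bar>u - of_int n\<bar> \<le> t" unfolding near_def by blast
  then have "n \<le> \<lfloor>u + t\<rfloor>" "- n \<le> \<lfloor>t - u\<rfloor>" by linarith+
  then have "near_ind u t \<ge> 1" unfolding near_ind_def by linarith
  with near_ind_cases[OF assms, of u] True show ?thesis by auto
next
  case False
  have "near_ind u t \<noteq> 1"
  proof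
    assume "near_ind u t = 1"
    then have *: "\<lfloor>t - u\<rfloor> = - \<lfloor>u + t\<rfloor>" unfolding near_ind_def by linarith
    have "of_int \<lfloor>u + t\<rfloor> \<le> u + t" by linarith
    moreover have "of_int \<lfloor>t - u\<rfloor> \<le> t - u" by linarith
    ultimately have "\<bar>u - of_int \<lfloor>u + t\<rfloor>\<bar> \<le> t" unfolding * of_int_minus by linarith
    with False show False unfolding near_def by blast
  qed
  with near_ind_cases[OF assms, of u] False show ?thesis by auto
qed

text \<open>The value is \<open>2n\<close> if \<open>u\<close> is within \<open>t\<close> of the integer \<open>n\<close>, and \<open>2n + 1\<close> if
  \<open>u\<close> lies in the rest of \<open>(n, n + 1)\<close>.\<close>

definition cell :: "real \<Rightarrow> real \<Rightarrow> int" where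
  "cell u t = \<lfloor>u + t\<rfloor> - \<lfloor>t - u\<rfloor>"

text \<open>Equal values mean the same integer or the same open unit interval. The thresholds may
  differ because points of different levels can share a hash value; around an integer the spread is
  at most t + t' < 1.\<close>

lemma cell_eq_imp_close:
  assumes t: "0 \<le> t" "t < 1/2" and t': "0 \<le> t'" "t' < 1/2" and eq: "cell u t = cell v t'"
  shows "\<bar>u - v\<bar> \<le> 1"
proof -
  have b: "of_int \<lfloor>u + t\<rfloor> \<le> u + t" "u + t < of_int \<lfloor>u + t\<rfloor> + 1"
    "of_int \<lfloor>t - u\<rfloor> \<le> t - u" "t - u < of_int \<lfloor>t - u\<rfloor> + 1"
    "of_int \<lfloor>v + t'\<rfloor> \<le> v + t'" "v + t' < of_int \<lfloor>v + t'\<rfloor> + 1"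
    "of_int \<lfloor>t' - v\<rfloor> \<le> t' - v" "t' - v < of_int \<lfloor>t' - v\<rfloor> + 1"
    by linarith+
  \<comment> \<open>\<open>cell\<close> and \<open>near_ind\<close> have opposite parity, so equal
    cells force equal indicators; sum and difference then determine both floors.\<close>
  have "near_ind u t = near_ind v t'"
    using near_ind_cases[OF t, of u] near_ind_cases[OF t', of v] eq
    unfolding near_ind_def cell_def by presburger
  then have e: "\<lfloor>u + t\<rfloor> = \<lfloor>v + t'\<rfloor>" "\<lfloor>t - u\<rfloor> = \<lfloor>t' - v\<rfloor>"
    using eq unfolding near_ind_def cell_def by presburger+
  from near_ind_cases[OF t, of u] show ?thesis
  proof
    assume "near_ind u t = 0"
    then have "\<lfloor>t - u\<rfloor> = - \<lfloor>u + t\<rfloor> - 1" unfolding near_ind_def by linarith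
    then have "real_of_int \<lfloor>t - u\<rfloor> = - of_int \<lfloor>u + t\<rfloor> - 1" by simp
    with b t t' show ?thesis unfolding e by linarith
  next
    assume "near_ind u t = 1"
    then have "\<lfloor>t - u\<rfloor> = - \<lfloor>u + t\<rfloor>" unfolding near_ind_def by linarith
    then have "real_of_int \<lfloor>t - u\<rfloor> = - of_int \<lfloor>u + t\<rfloor>" by simp
    with b t t' show ?thesis unfolding e by linarith
  qed
qed

text \<open>The last two hypotheses exclude distances to the nearest integer in (t, t + e], so a
  move by at most e cannot change nearness. Equal indicators leave only the first floor to
  compare.\<close>

lemma cell_eqI:
  assumes t: "0 \<le> t" "t < 1/2" and e: "2 * t + e < 1" and close: "\<bar>u - v\<bar> \<le> e"
    and u: "near u (t + e) \<Longrightarrow> near u t" and v: "near v (t + e) \<Longrightarrow> near v t"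
  shows "cell u t = cell v t"
proof -
  have "near u t \<longleftrightarrow> near v t"
    using near_perturb[of u t v e] near_perturb[of v t u e] u v close by (auto simp: abs_minus_commute)
  then have ind: "near_ind u t = near_ind v t" by (simp add: near_ind_eq[OF t])
  have b: "of_int \<lfloor>u + t\<rfloor> \<le> u + t" "u + t < of_int \<lfloor>u + t\<rfloor> + 1"
    "of_int \<lfloor>t - u\<rfloor> \<le> t - u" "t - u < of_int \<lfloor>t - u\<rfloor> + 1"
    "of_int \<lfloor>v + t\<rfloor> \<le> v + t" "v + t < of_int \<lfloor>v + t\<rfloor> + 1"
    "of_int \<lfloor>t - v\<rfloor> \<le> t - v" "t - v < of_int \<lfloor>t - v\<rfloor> + 1"
    by linarith+
  have "\<lfloor>u + t\<rfloor> = \<lfloor>v + t\<rfloor>"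
  proof (cases "near u t")
    case True
    then have "near_ind u t = 1" "near_ind v t = 1" using ind by (simp_all add: near_ind_eq[OF t])
    then have "\<lfloor>t - u\<rfloor> = - \<lfloor>u + t\<rfloor>" "\<lfloor>t - v\<rfloor> = - \<lfloor>v + t\<rfloor>" unfolding near_ind_def by linarith+
    then have "real_of_int \<lfloor>t - u\<rfloor> = - of_int \<lfloor>u + t\<rfloor>" "real_of_int \<lfloor>t - v\<rfloor> = - of_int \<lfloor>v + t\<rfloor>"
      by simp_all
    with b e close have "\<bar>real_of_int (\<lfloor>u + t\<rfloor> - \<lfloor>v + t\<rfloor>)\<bar> < 1" unfolding of_int_diff by linarith
    then show ?thesis by linarith
  next
    case False
    with u have nu: "\<And>n::int. \<bar>u - of_int n\<bar> > t + e" unfolding near_def by (meson not_le)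
    from False v \<open>near u t \<longleftrightarrow> near v t\<close>
    have nv: "\<And>n::int. \<bar>v - of_int n\<bar> > t + e" unfolding near_def by (meson not_le)
    \<comment> \<open>An integer that is at most v + t is in fact more than t + e below v, hence
      also below u.\<close>
    have "\<not> \<lfloor>u + t\<rfloor> < \<lfloor>v + t\<rfloor>"
    proof
      assume "\<lfloor>u + t\<rfloor> < \<lfloor>v + t\<rfloor>"
      then have "real_of_int \<lfloor>u + t\<rfloor> + 1 \<le> of_int \<lfloor>v + t\<rfloor>" by linarith
      with b nv[of "\<lfloor>v + t\<rfloor>"] close t show False by linarith
    qed
    moreover have "\<not> \<lfloor>v + t\<rfloor> < \<lfloor>u + t\<rfloor>"
    proof
      assume "\<lfloor>v + t\<rfloor> < \<lfloor>u + t\<rfloor>"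
      then have "real_of_int \<lfloor>v + t\<rfloor> + 1 \<le> of_int \<lfloor>u + t\<rfloor>" by linarith
      with b nu[of "\<lfloor>u + t\<rfloor>"] close t show False by linarith
    qed
    ultimately show ?thesis by linarith
  qed
  with ind show ?thesis unfolding near_ind_def cell_def by linarith
qed

section \<open>Counting near coordinates, and the gap at the level of a point\<close>

definition near_count :: "nat \<Rightarrow> (nat \<Rightarrow> real) \<Rightarrow> real \<Rightarrow> int" where
  "near_count d u t = (\<Sum>j<d. near_ind (u j) t)"

lemma near_count_eq_card:
  assumes "0 \<le> t" "t < 1/2"
  shows "near_count d u t = int (card {j. j < d \<and> near (u j) t})"
proof -
  have "near_count d u t = (\<Sum>j<d. of_bool (near (u j) t))"
    unfolding near_count_def by (simp add: near_ind_eq[OF assms])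
  also have "\<dots> = int (card ({..<d} \<inter> {j. near (u j) t}))" by simp
  also have "{..<d} \<inter> {j. near (u j) t} = {j. j < d \<and> near (u j) t}" by auto
  finally show ?thesis .
qed

text \<open>2d + 3 is the least integer K with (d + 1) / K < 1/2, so all thresholds up to the one
  tested at level d stay where \<open>near_ind\<close> is an indicator.\<close>

definition gap :: "nat \<Rightarrow> real" where
  "gap d = 1 / (2 * real d + 3)"

lemma gap_pos: "0 < gap d"
  by (simp add: gap_def)

lemma multiple_gap_bounds:
  assumes "m \<le> d"
  shows "0 \<le> real m * gap d" "real m * gap d < 1/2" "2 * (real m * gap d) + gap d < 1"
  using assms by (simp_all add: gap_def field_simps)

lemma Suc_multiple_gap_bounds:
  assumes "m \<le> d"
  shows "0 \<le> (real m + 1) * gap d" "(real m + 1) * gap d < 1/2"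
  using assms by (simp_all add: gap_def field_simps)

definition level :: "nat \<Rightarrow> (nat \<Rightarrow> real) \<Rightarrow> nat" where
  "level d u = (LEAST m. near_count d u ((real m + 1) * gap d) \<le> int m)"

lemma near_count_le_dim:
  assumes "0 \<le> t" "t < 1/2"
  shows "near_count d u t \<le> int d"
proof -
  have "card {j. j < d \<and> near (u j) t} \<le> card {..<d}" by (rule card_mono) auto
  then show ?thesis by (simp add: near_count_eq_card[OF assms])
qed

lemma near_count_level: "near_count d u ((real (level d u) + 1) * gap d) \<le> int (level d u)"
  unfolding level_def
  \<comment> \<open>d always qualifies, as at most d coordinates can be near.\<close>
  by (rule LeastI[of _ d]) (use near_count_le_dim Suc_multiple_gap_bounds in simp)

lemma level_le: "level d u \<le> d"
  unfolding level_def
  by (rule Least_le) (use near_count_le_dim Suc_multiple_gap_bounds in simp)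

lemma level_minimal: "m < level d u \<Longrightarrow> int m < near_count d u ((real m + 1) * gap d)"
  unfolding level_def using not_less_Least by (meson not_le)

text \<open>Pigeonhole: the coordinates near at the smaller threshold are among those near at the
  larger one. With m the level, there are at least m of the former and at most m of the latter, so
  the sets coincide.\<close>

lemma level_gap:
  assumes j: "j < d" and "near (u j) ((real (level d u) + 1) * gap d)"
  shows "near (u j) (real (level d u) * gap d)"
proof -
  let ?m = "level d u"
  let ?A = "{j. j < d \<and> near (u j) (real ?m * gap d)}"
  let ?B = "{j. j < d \<and> near (u j) ((real ?m + 1) * gap d)}"
  have sub: "?A \<subseteq> ?B" using gap_pos[of d] by (auto elim!: near_mono simp: algebra_simps)
  have "card ?B \<le> ?m"
    using near_count_level[of d u] by (simp add: near_count_eq_card[OF Suc_multiple_gap_bounds[OF level_le]])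
  moreover have "?m \<le> card ?A"
  proof (cases ?m)
    case (Suc k)
    \<comment> \<open>The preceding candidate failed, and its threshold is exactly the smaller one
      here.\<close>
    then have "int k < near_count d u ((real k + 1) * gap d)" by (intro level_minimal) simp
    also have "(real k + 1) * gap d = real ?m * gap d" by (simp add: Suc)
    finally have "int k < int (card ?A)"
      by (simp only: near_count_eq_card[OF multiple_gap_bounds(1,2)[OF level_le]])
    then show ?thesis using Suc by linarith
  qed simp
  ultimately have "?A = ?B" by (intro card_seteq sub) auto
  with assms show ?thesis by blast
qed

section \<open>The hash on all coordinates and its two diameter bounds\<close>

definition lattice_hash :: "nat \<Rightarrow> real \<Rightarrow> (nat \<Rightarrow> real) \<Rightarrow> nat \<Rightarrow> real" where
  "lattice_hash d q x = (\<lambda>j. if j < d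
     then of_int (cell (x j * q) (real (level d (\<lambda>i. x i * q)) * gap d)) else 0)"

lemma lattice_hash_eqD:
  assumes "lattice_hash d q x = lattice_hash d q y" "j < d"
  shows "\<bar>x j * q - y j * q\<bar> \<le> 1"
proof -
  have "lattice_hash d q x j = lattice_hash d q y j" using assms by simp
  with \<open>j < d\<close> show ?thesis
    by (intro cell_eq_imp_close[OF multiple_gap_bounds(1,2)[OF level_le] multiple_gap_bounds(1,2)[OF level_le]])
      (simp add: lattice_hash_def)
qed

lemma lattice_hash_eqI:
  assumes lev: "level d (\<lambda>i. x i * q) = level d (\<lambda>i. y i * q)"
    and close: "\<And>j. j < d \<Longrightarrow> \<bar>x j * q - y j * q\<bar> \<le> gap d"
  shows "lattice_hash d q x = lattice_hash d q y"
proof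
  fix j
  let ?t = "real (level d (\<lambda>i. x i * q)) * gap d"
  show "lattice_hash d q x j = lattice_hash d q y j"
  proof (cases "j < d")
    case True
    have "cell (x j * q) ?t = cell (y j * q) ?t"
    proof (rule cell_eqI)
      show "near (x j * q) ?t" if "near (x j * q) (?t + gap d)"
        using level_gap[OF True, of "\<lambda>i. x i * q"] that by (simp add: algebra_simps)
      show "near (y j * q) ?t" if "near (y j * q) (?t + gap d)"
        using level_gap[OF True, of "\<lambda>i. y i * q"] that unfolding lev by (simp add: algebra_simps)
    qed (use multiple_gap_bounds[OF level_le] close True in auto)
    then show ?thesis using lev by (simp add: lattice_hash_def)
  qed (simp add: lattice_hash_def)
qed

lemma eucl_dist_le_of_coord:
  assumes "\<And>j. j < d \<Longrightarrow> \<bar>x j - y j\<bar> \<le> b" "0 \<le> b"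
  shows "eucl_dist d x y \<le> sqrt (real d) * b"
proof -
  have "(\<Sum>i<d. (x i - y i)\<^sup>2) \<le> (\<Sum>i<d. b\<^sup>2)"
    using assms by (intro sum_mono) (metis abs_le_square_iff abs_of_nonneg lessThan_iff)
  then have "eucl_dist d x y \<le> sqrt (real d * b\<^sup>2)"
    unfolding eucl_dist_def L2_set_def by (intro real_sqrt_le_mono) simp
  also have "\<dots> = sqrt (real d) * b" using assms by (simp add: real_sqrt_mult)
  finally show ?thesis .
qed

lemma coord_le_eucl_dist: "j < d \<Longrightarrow> \<bar>x j - y j\<bar> \<le> eucl_dist d x y"
  unfolding eucl_dist_def L2_set_def
  by (intro real_le_rsqrt) (use member_le_sum[of j "{..<d}" "\<lambda>i. (x i - y i)\<^sup>2"] in auto)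

lemma eucl_dist_le_of_diam:
  assumes "eucl_diam d S \<le> ennreal b" "0 \<le> b" "x \<in> S" "y \<in> S"
  shows "eucl_dist d x y \<le> b"
proof -
  have "ennreal (eucl_dist d x y) \<le> eucl_diam d S"
    unfolding eucl_diam_def using assms by (meson SUP_upper2 order_refl)
  with assms have "ennreal (eucl_dist d x y) \<le> ennreal b" by (meson order_trans)
  with \<open>0 \<le> b\<close> show ?thesis by simp
qed

text \<open>On S, f is a function of g. With g the level, this bounds the number of hash values by
  the number of levels.\<close>

lemma card_image_le_of_factor:
  assumes "finite (g ` S)" "\<And>x y. x \<in> S \<Longrightarrow> y \<in> S \<Longrightarrow> g x = g y \<Longrightarrow> f x = f y"
  shows "finite (f ` S)" "card (f ` S) \<le> card (g ` S)"
proof -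
  have "f x = f (inv_into S g (g x))" if "x \<in> S" for x
    using that by (intro assms(2)) (auto simp: inv_into_into f_inv_into_f)
  then have eq: "f ` S = (\<lambda>k. f (inv_into S g k)) ` (g ` S)"
    unfolding image_image by (intro image_cong) auto
  show "finite (f ` S)" unfolding eq by (rule finite_imageI[OF assms(1)])
  show "card (f ` S) \<le> card (g ` S)" unfolding eq by (rule card_image_le[OF assms(1)])
qed

text \<open>In the original coordinates the cubes have side l / s, hence diameter at most l. A
  coordinate moves no more than the Euclidean distance, so the local bound costs no second factor
  sqrt d.\<close>

theorem is_hash_lattice_hash:
  assumes l: "0 < l" and s: "0 < s" "sqrt (real d) \<le> s"
  shows "is_hash d (s * (2 * real d + 3)) (d + 1) l (lattice_hash d (s / l))"
proof -
  let ?E = "topspace (Euclidean_space d)"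
  let ?h = "lattice_hash d (s / l)"
  have maps: "?h \<in> ?E \<rightarrow> ?E"
    by (auto simp: topspace_Euclidean_space lattice_hash_def)
  have fibre: "eucl_diam d {x \<in> ?E. ?h x = z} \<le> ennreal l" for z
    unfolding eucl_diam_def
  proof (intro SUP_least ennreal_leI)
    fix x y assume "x \<in> {x \<in> ?E. ?h x = z}" "y \<in> {x \<in> ?E. ?h x = z}"
    then have eq: "?h x = ?h y" by simp
    have "eucl_dist d x y \<le> sqrt (real d) * (l / s)"
    proof (rule eucl_dist_le_of_coord)
      fix j assume "j < d"
      have "\<bar>x j - y j\<bar> * (s / l) = \<bar>x j * (s / l) - y j * (s / l)\<bar>"
        using l s by (simp add: left_diff_distrib[symmetric] abs_mult del: times_divide_eq_right)
      also have "\<dots> \<le> 1" by (rule lattice_hash_eqD[OF eq \<open>j < d\<close>])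
      finally show "\<bar>x j - y j\<bar> \<le> l / s" using l s by (simp add: field_simps)
    qed (use l s in simp)
    also have "\<dots> \<le> s * (l / s)" using l s by (intro mult_right_mono) auto
    finally show "eucl_dist d x y \<le> l" using s by simp
  qed
  have local: "finite (?h ` S) \<and> card (?h ` S) \<le> d + 1"
    if diam: "eucl_diam d S \<le> ennreal (l / (s * (2 * real d + 3)))" for S
  proof -
    let ?lev = "\<lambda>x. level d (\<lambda>i. x i * (s / l))"
    have sub: "?lev ` S \<subseteq> {..d}" using level_le by auto
    have fin: "finite (?lev ` S)" by (rule finite_subset[OF sub]) simp
    have eq: "?h x = ?h y" if xy: "x \<in> S" "y \<in> S" "?lev x = ?lev y" for x y
    proof (rule lattice_hash_eqI[OF xy(3)])
      fix j assume "j < d"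
      have "\<bar>x j - y j\<bar> \<le> l / (s * (2 * real d + 3))"
        using coord_le_eucl_dist[OF \<open>j < d\<close>, of x y] eucl_dist_le_of_diam[OF diam _ xy(1,2)] l s
        by fastforce
      then have "\<bar>x j - y j\<bar> * (s / l) \<le> l / (s * (2 * real d + 3)) * (s / l)"
        using l s by (intro mult_right_mono) auto
      \<comment> \<open>This fixes \<open>\<Gamma>\<close>: scaling by s / l turns the diameter l /
        (s (2d + 3)) into exactly one gap.\<close>
      also have "\<dots> = gap d" using l s by (simp add: gap_def)
      finally show "\<bar>x j * (s / l) - y j * (s / l)\<bar> \<le> gap d"
        using l s by (simp add: left_diff_distrib[symmetric] abs_mult del: times_divide_eq_right)
    qed
    have "card (?h ` S) \<le> card (?lev ` S)" by (rule card_image_le_of_factor[OF fin eq])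
    also have "\<dots> \<le> card {..d}" by (rule card_mono[OF _ sub]) simp
    finally show ?thesis using card_image_le_of_factor(1)[OF fin eq] by simp
  qed
  show ?thesis
    unfolding is_hash_def using l s maps fibre local by auto
qed

section \<open>An integer scale of order sqrt d\<close>

definition ceil_sqrt :: "nat \<Rightarrow> nat" where
  "ceil_sqrt d = (LEAST s. d \<le> s * s)"

lemma ceil_sqrt_ge: "d \<le> ceil_sqrt d * ceil_sqrt d"
  unfolding ceil_sqrt_def by (rule LeastI[of _ d]) simp

lemma ceil_sqrt_le: "ceil_sqrt d \<le> d"
  unfolding ceil_sqrt_def by (rule Least_le) simp

lemma ceil_sqrt_minimal: "s < ceil_sqrt d \<Longrightarrow> s * s < d"
  unfolding ceil_sqrt_def using not_less_Least by (meson not_le)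

lemma sqrt_le_ceil_sqrt: "sqrt (real d) \<le> real (ceil_sqrt d)"
  using ceil_sqrt_ge[of d] by (intro real_le_lsqrt) (auto simp: power2_eq_square simp flip: of_nat_mult)

lemma ceil_sqrt_le_sqrt: "real (ceil_sqrt d) \<le> sqrt (real d) + 1"
proof (cases "ceil_sqrt d")
  case (Suc k)
  then have "k * k < d" by (intro ceil_sqrt_minimal) simp
  then have "real k \<le> sqrt (real d)"
    by (intro real_le_rsqrt) (auto simp: power2_eq_square simp flip: of_nat_mult)
  with Suc show ?thesis by simp
qed simp

lemma ceil_sqrt_bigtheta: "(\<lambda>d. real (ceil_sqrt d) * (2 * real d + 3)) \<in> \<Theta>(\<lambda>d. real d * sqrt (real d))"
proof (rule bigthetaI)
  show "(\<lambda>d. real (ceil_sqrt d) * (2 * real d + 3)) \<in> O(\<lambda>d. real d * sqrt (real d))"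
  \<comment> \<open>For d \<ge> 1 the rounded root is at most 2 sqrt d and 2d + 3 \<le> 5d, whence
    10 = 2 * 5.\<close>
  proof (rule bigoI[of _ 10])
    show "\<forall>\<^sub>F d in at_top. norm (real (ceil_sqrt d) * (2 * real d + 3)) \<le> 10 * norm (real d * sqrt (real d))"
      using eventually_ge_at_top[of 1]
    proof eventually_elim
      case (elim d)
      then have "1 \<le> sqrt (real d)" by simp
      with ceil_sqrt_le_sqrt[of d] have "real (ceil_sqrt d) \<le> 2 * sqrt (real d)" by linarith
      then have "real (ceil_sqrt d) * (2 * real d + 3) \<le> (2 * sqrt (real d)) * (5 * real d)"
        using elim by (intro mult_mono) auto
      then show ?case by (simp add: algebra_simps)
    qed
  qed
  show "(\<lambda>d. real (ceil_sqrt d) * (2 * real d + 3)) \<in> \<Omega>(\<lambda>d. real d * sqrt (real d))"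
    unfolding bigomega_iff_bigo
  proof (rule bigoI[of _ 1], rule always_eventually, rule allI)
    fix d
    have "real d * sqrt (real d) \<le> (2 * real d + 3) * real (ceil_sqrt d)"
      using sqrt_le_ceil_sqrt[of d] by (intro mult_mono) auto
    then show "norm (real d * sqrt (real d)) \<le> 1 * norm (real (ceil_sqrt d) * (2 * real d + 3))"
      by (simp add: mult.commute)
  qed
qed

section \<open>The program\<close>

definition runs :: "instr list \<Rightarrow> nat \<Rightarrow> nat \<Rightarrow> config \<Rightarrow> (config \<Rightarrow> bool) \<Rightarrow> bool" where
  "runs P s n c Q \<longleftrightarrow> Q ((step P ^^ n) c) \<and> (\<forall>k<n. within_space P s ((step P ^^ k) c))"

text \<open>\<open>runs\<close> fixes the exact number of steps, which suits straight-line code; an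
  upper bound composes better across loops whose iteration count depends on the input.\<close>

definition ensures :: "instr list \<Rightarrow> nat \<Rightarrow> nat \<Rightarrow> config \<Rightarrow> (config \<Rightarrow> bool) \<Rightarrow> bool" where
  "ensures P s t c Q \<longleftrightarrow> (\<exists>n\<le>t. runs P s n c Q)"

lemma runs_0: "runs P s 0 c Q \<longleftrightarrow> Q c"
  by (simp add: runs_def)

lemma runs_Suc: "runs P s (Suc n) c Q \<longleftrightarrow> within_space P s c \<and> runs P s n (step P c) Q"
  unfolding runs_def All_less_Suc2 by (auto simp: funpow_swap1)

lemma runs_numeral:
  "runs P s (numeral k) c Q \<longleftrightarrow> within_space P s c \<and> runs P s (pred_numeral k) (step P c) Q"
  by (simp add: numeral_eq_Suc runs_Suc)

lemma runs_add: "runs P s (n + n') c Q \<longleftrightarrow> runs P s n c (\<lambda>c'. runs P s n' c' Q)"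
  by (induction n arbitrary: c) (simp_all add: runs_0 runs_Suc)

text \<open>The sequencing rule: a block of n known steps, then a continuation with budget t. Each
  loop below takes its continuation as the premise \<open>exit\<close> with budget T.\<close>

lemma ensures_runs:
  assumes "runs P s n c (\<lambda>c'. ensures P s t c' Q)" "n + t \<le> t'"
  shows "ensures P s t' c Q"
proof -
  let ?c = "(step P ^^ n) c"
  from assms(1) obtain n' where "n' \<le> t" "runs P s n' ?c Q" unfolding runs_def ensures_def by blast
  moreover from assms(1) this have "runs P s (n + n') c Q" unfolding runs_add by (simp add: runs_def)
  ultimately show ?thesis unfolding ensures_def using assms(2) by (intro exI[of _ "n + n'"]) simp
qed

lemma ensures_now: "Q c \<Longrightarrow> ensures P s t c Q"
  unfolding ensures_def by (intro exI[of _ 0]) (simp add: runs_0)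

text \<open>Registers: 0 holds \<open>d\<close>, 1 holds \<open>l\<close>, 2 the constant 1, 3 holds \<open>ceil_sqrt d\<close>, 4 the
  scaling factor, 5 holds \<open>gap d\<close>, 6 the candidate level, 7 the count, 8 the loop index,
  9 the threshold; 10 and 11 are scratch. \<open>JumpLe _ 0 0\<close> is an unconditional jump.\<close>

definition hash_prog :: "instr list" where
  "hash_prog = [
     Const 2 1,
     Mul 10 3 3,
     JumpLe 5 0 10,
     Add 3 3 2,
     JumpLe 1 0 0,
     Div 4 3 1,
     Add 10 0 0,
     Const 11 3,
     Add 10 10 11,
     Div 5 2 10,
     Add 9 6 2,
     Mul 9 9 5,
     Const 7 0,
     Const 8 0,
     JumpLe 26 0 8,
     Load 10 8,
     Mul 10 10 4,
     Sub 11 9 10,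
     Floor 11 11,
     Add 10 10 9,
     Floor 10 10,
     Add 7 7 10,
     Add 7 7 11,
     Add 7 7 2,
     Add 8 8 2,
     JumpLe 14 0 0,
     JumpLe 29 7 6,
     Add 6 6 2,
     JumpLe 10 0 0,
     Mul 9 6 5,
     Const 8 0,
     JumpLe 42 0 8,
     Load 10 8,
     Mul 10 10 4,
     Sub 11 9 10,
     Floor 11 11,
     Add 10 10 9,
     Floor 10 10,
     Sub 10 10 11,
     Store 8 10,
     Add 8 8 2,
     JumpLe 31 0 0]"

section \<open>Correctness and cost of the hash program\<close>

lemma length_hash_prog: "length hash_prog = 42"
  by (simp add: hash_prog_def)

lemma step_hash_prog:
  "pc < 42 \<Longrightarrow> step hash_prog (pc, r, m) = exec_instr (hash_prog ! pc) (pc, r, m)"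
  by (simp add: step_def halted_def length_hash_prog)

lemma within_space_hash_prog:
  "pc < 42 \<Longrightarrow> within_space hash_prog s (pc, r, m) \<longleftrightarrow>
     regs_used (hash_prog ! pc) \<union> mem_used (hash_prog ! pc) r \<subseteq> {..<s}"
  by (simp add: within_space_def halted_def length_hash_prog)

lemma addr_of_nat [simp]: "addr (real n) = n"
  by (simp add: addr_def)

lemmas run_simps = numeral_2_eq_2[symmetric] runs_0 runs_Suc runs_numeral step_hash_prog within_space_hash_prog

lemma hash_prog_nth:
  "hash_prog ! 0 = Const 2 1"
  "hash_prog ! Suc 0 = Mul 10 3 3"
  "hash_prog ! 2 = JumpLe 5 0 10"
  "hash_prog ! 3 = Add 3 3 2"
  "hash_prog ! 4 = JumpLe 1 0 0"
  "hash_prog ! 5 = Div 4 3 1"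
  "hash_prog ! 6 = Add 10 0 0"
  "hash_prog ! 7 = Const 11 3"
  "hash_prog ! 8 = Add 10 10 11"
  "hash_prog ! 9 = Div 5 2 10"
  "hash_prog ! 10 = Add 9 6 2"
  "hash_prog ! 11 = Mul 9 9 5"
  "hash_prog ! 12 = Const 7 0"
  "hash_prog ! 13 = Const 8 0"
  "hash_prog ! 14 = JumpLe 26 0 8"
  "hash_prog ! 15 = Load 10 8"
  "hash_prog ! 16 = Mul 10 10 4"
  "hash_prog ! 17 = Sub 11 9 10"
  "hash_prog ! 18 = Floor 11 11"
  "hash_prog ! 19 = Add 10 10 9"
  "hash_prog ! 20 = Floor 10 10"
  "hash_prog ! 21 = Add 7 7 10"
  "hash_prog ! 22 = Add 7 7 11"
  "hash_prog ! 23 = Add 7 7 2"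
  "hash_prog ! 24 = Add 8 8 2"
  "hash_prog ! 25 = JumpLe 14 0 0"
  "hash_prog ! 26 = JumpLe 29 7 6"
  "hash_prog ! 27 = Add 6 6 2"
  "hash_prog ! 28 = JumpLe 10 0 0"
  "hash_prog ! 29 = Mul 9 6 5"
  "hash_prog ! 30 = Const 8 0"
  "hash_prog ! 31 = JumpLe 42 0 8"
  "hash_prog ! 32 = Load 10 8"
  "hash_prog ! 33 = Mul 10 10 4"
  "hash_prog ! 34 = Sub 11 9 10"
  "hash_prog ! 35 = Floor 11 11"
  "hash_prog ! 36 = Add 10 10 9"
  "hash_prog ! 37 = Floor 10 10"
  "hash_prog ! 38 = Sub 10 10 11"
  "hash_prog ! 39 = Store 8 10"
  "hash_prog ! 40 = Add 8 8 2"
  "hash_prog ! 41 = JumpLe 31 0 0"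
  by (simp_all add: hash_prog_def)

text \<open>Register 3 holds a candidate k not beyond the answer. A rejected candidate costs 4
  steps, the accepted one 2. Register 6 is tracked because the level search relies on its initial
  0.\<close>

lemma sqrt_loop:
  assumes s: "12 \<le> s"
    and exit: "\<And>r'. \<lbrakk>r' 0 = real d; r' (Suc 0) = l; r' 2 = 1; r' 3 = real (ceil_sqrt d); r' 6 = 0\<rbrakk>
      \<Longrightarrow> ensures hash_prog s T (5, r', x) Q"
    and r: "r 0 = real d" "r (Suc 0) = l" "r 2 = 1" "r 3 = real k" "r 6 = 0"
    and k: "k \<le> ceil_sqrt d"
  shows "ensures hash_prog s (4 * (ceil_sqrt d - k) + 2 + T) (Suc 0, r, x) Q"
  using r k
proof (induction "ceil_sqrt d - k" arbitrary: k r)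
  case 0
  then have "k = ceil_sqrt d" by simp
  with ceil_sqrt_ge[of d] have "real d \<le> real k * real k" by (simp flip: of_nat_mult)
  with 0 s \<open>k = ceil_sqrt d\<close> show ?case
    by (intro ensures_runs[where n = 2 and t = T]) (simp_all add: run_simps hash_prog_nth exit)
next
  case (Suc n)
  then have k: "k < ceil_sqrt d" by simp
  then have "\<not> real d \<le> real k * real k"
    using ceil_sqrt_minimal by (simp add: not_le flip: of_nat_mult)
  moreover have "ensures hash_prog s (4 * (ceil_sqrt d - Suc k) + 2 + T) (Suc 0, r', x) Q"
    if "r' 0 = real d" "r' (Suc 0) = l" "r' 2 = 1" "r' 3 = real k + 1" "r' 6 = 0" for r'
    using that k Suc.hyps(2) by (intro Suc.hyps(1)) auto
  ultimately show ?case
    using Suc.prems s k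
    by (intro ensures_runs[where n = 4 and t = "4 * (ceil_sqrt d - Suc k) + 2 + T"])
      (simp_all add: run_simps hash_prog_nth)
qed

text \<open>Register 7 holds the count over the first j coordinates. Each coordinate costs 12 steps
  and the exit test 1; memory is only read, so x survives for the next candidate level.\<close>

lemma count_loop:
  assumes s: "12 \<le> s" "d \<le> s"
    and exit: "\<And>r'. \<lbrakk>r' 0 = real d; r' 2 = 1; r' 4 = q; r' 5 = e; r' 6 = real m;
        r' 7 = of_int (near_count d (\<lambda>i. x i * q) t)\<rbrakk>
      \<Longrightarrow> ensures hash_prog s T (26, r', x) Q"
    and r: "r 0 = real d" "r 2 = 1" "r 4 = q" "r 5 = e" "r 6 = real m"
      "r 7 = of_int (near_count j (\<lambda>i. x i * q) t)" "r 8 = real j" "r 9 = t"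
    and j: "j \<le> d"
  shows "ensures hash_prog s (12 * (d - j) + 1 + T) (14, r, x) Q"
  using r j
proof (induction "d - j" arbitrary: j r)
  case 0
  then show ?case
    using s by (intro ensures_runs[where n = 1 and t = T]) (simp_all add: run_simps hash_prog_nth exit)
next
  case (Suc n)
  then have j: "j < d" by simp
  moreover have "ensures hash_prog s (12 * (d - Suc j) + 1 + T) (14, r', x) Q"
    if "r' 0 = real d" "r' 2 = 1" "r' 4 = q" "r' 5 = e" "r' 6 = real m"
      "r' 7 = of_int (near_count j (\<lambda>i. x i * q) t) + of_int \<lfloor>x j * q + t\<rfloor> + of_int \<lfloor>t - x j * q\<rfloor> + 1"
      "r' 8 = real j + 1" "r' 9 = t" for r'
    using that j Suc.hyps(2)
    by (intro Suc.hyps(1)) (auto simp: near_count_def near_ind_def)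
  ultimately show ?case
    using Suc.prems s
    by (intro ensures_runs[where n = 12 and t = "12 * (d - Suc j) + 1 + T"])
      (simp_all add: run_simps hash_prog_nth)
qed

text \<open>A rejected level costs 4 steps of setup, 12d + 1 of counting and 3 to reject and jump
  back, together 12d + 8. The accepted one needs a single test after counting, hence 12d +
  6.\<close>

lemma level_loop:
  assumes s: "12 \<le> s" "d \<le> s"
    and exit: "\<And>r'. \<lbrakk>r' 0 = real d; r' 2 = 1; r' 4 = q; r' 5 = gap d; r' 6 = real (level d (\<lambda>i. x i * q))\<rbrakk>
      \<Longrightarrow> ensures hash_prog s T (29, r', x) Q"
    and r: "r 0 = real d" "r 2 = 1" "r 4 = q" "r 5 = gap d" "r 6 = real m"
    and m: "m \<le> level d (\<lambda>i. x i * q)"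
  shows "ensures hash_prog s ((12 * d + 8) * (level d (\<lambda>i. x i * q) - m) + (12 * d + 6) + T) (10, r, x) Q"
  using r m
proof (induction "level d (\<lambda>i. x i * q) - m" arbitrary: m r)
  let ?L = "level d (\<lambda>i. x i * q)"
  case 0
  then have m: "m = ?L" by simp
  have "ensures hash_prog s (1 + T) (26, r', x) Q"
    if "r' 0 = real d" "r' 2 = 1" "r' 4 = q" "r' 5 = gap d" "r' 6 = real m"
      "r' 7 = of_int (near_count d (\<lambda>i. x i * q) ((real m + 1) * gap d))" for r'
  proof -
    have "real_of_int (near_count d (\<lambda>i. x i * q) ((real m + 1) * gap d)) \<le> real_of_int (int m)"
      unfolding m of_int_le_iff by (rule near_count_level)
    with that s m show ?thesis
      by (intro ensures_runs[where n = 1 and t = T]) (simp_all add: run_simps hash_prog_nth exit)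
  qed
  note count = count_loop[OF s this, where j = 0]
  show ?case
    by (rule ensures_runs[where n = 4 and t = "12 * (d - 0) + 1 + (1 + T)"])
      (use 0 s in \<open>auto simp: run_simps hash_prog_nth near_count_def intro!: count[simplified]\<close>)
next
  let ?L = "level d (\<lambda>i. x i * q)"
  case (Suc n)
  then have m: "m < ?L" by simp
  let ?T = "(12 * d + 8) * (?L - Suc m) + (12 * d + 6) + T"
  have again: "ensures hash_prog s ?T (10, r', x) Q"
    if "r' 0 = real d" "r' 2 = 1" "r' 4 = q" "r' 5 = gap d" "r' 6 = real m + 1" for r'
    using that m Suc.hyps(2) by (intro Suc.hyps(1)) auto
  have "ensures hash_prog s (3 + ?T) (26, r', x) Q"
    if "r' 0 = real d" "r' 2 = 1" "r' 4 = q" "r' 5 = gap d" "r' 6 = real m"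
      "r' 7 = of_int (near_count d (\<lambda>i. x i * q) ((real m + 1) * gap d))" for r'
  proof -
    have "real_of_int (int m) < real_of_int (near_count d (\<lambda>i. x i * q) ((real m + 1) * gap d))"
      unfolding of_int_less_iff by (rule level_minimal[OF m])
    with that s m again show ?thesis
      by (intro ensures_runs[where n = 3 and t = ?T]) (simp_all add: run_simps hash_prog_nth)
  qed
  note loop = count_loop[OF s this, where j = 0, unfolded diff_zero]
  define U where "U = 12 * d + 1 + (3 + ?T)"
  have "ensures hash_prog s U (14, r', x) Q"
    if "r' 0 = real d" "r' 2 = 1" "r' 4 = q" "r' 5 = gap d" "r' 6 = real m" "r' 7 = 0" "r' 8 = 0"
      "r' 9 = (real m + 1) * gap d" for r'
    unfolding U_def by (rule loop) (use that in \<open>simp_all add: near_count_def\<close>)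
  then have "runs hash_prog s 4 (10, r, x) (\<lambda>c. ensures hash_prog s U c Q)"
    using Suc.prems s
    by (simp add: run_simps hash_prog_nth)
  moreover have "4 + U = (12 * d + 8) * (?L - m) + (12 * d + 6) + T"
    using m by (simp add: U_def Suc_diff_Suc[symmetric])
  ultimately show ?case by (intro ensures_runs) auto
qed

text \<open>Overwriting the input in place is safe: the threshold is already fixed, and the value
  for coordinate j depends only on it and x j. Each coordinate costs 11 steps.\<close>

lemma output_loop:
  assumes s: "12 \<le> s" "d \<le> s"
    and exit: "\<And>r' y'. \<lbrakk>\<And>i. i < d \<Longrightarrow> y' i = of_int (cell (x i * q) t)\<rbrakk>
      \<Longrightarrow> ensures hash_prog s T (42, r', y') Q"
    and r: "r 0 = real d" "r 2 = 1" "r 4 = q" "r 8 = real j" "r 9 = t"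
    and y: "\<And>i. y i = (if i < j then of_int (cell (x i * q) t) else x i)"
    and j: "j \<le> d"
  shows "ensures hash_prog s (11 * (d - j) + 1 + T) (31, r, y) Q"
  using r y j
proof (induction "d - j" arbitrary: j r y)
  case 0
  then show ?case
    using s by (intro ensures_runs[where n = 1 and t = T]) (simp_all add: run_simps hash_prog_nth exit)
next
  case (Suc n)
  then have j: "j < d" by simp
  have yj: "y j = x j" using Suc.prems by simp
  moreover have "ensures hash_prog s (11 * (d - Suc j) + 1 + T)
      (31, r', y(j := of_int \<lfloor>x j * q + t\<rfloor> - of_int \<lfloor>t - x j * q\<rfloor>)) Q"
    if "r' 0 = real d" "r' 2 = 1" "r' 4 = q" "r' 8 = real j + 1" "r' 9 = t" for r'
    using that j Suc.hyps(2) Suc.prems(6)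
    by (intro Suc.hyps(1)) (auto simp: cell_def less_Suc_eq)
  ultimately show ?case
    using Suc.prems(1-5) s j
    by (intro ensures_runs[where n = 11 and t = "11 * (d - Suc j) + 1 + T"])
      (simp_all add: run_simps hash_prog_nth)
qed

lemma hash_prog_correct:
  assumes s: "12 \<le> s" "d \<le> s"
  shows "ensures hash_prog s (12 * d * d + 35 * d + 22) (init_config d l x)
    (\<lambda>(pc, r, y). pc = 42 \<and> (\<forall>i<d. y i = lattice_hash d (real (ceil_sqrt d) / l) x i))"
    (is "ensures _ _ _ _ ?Q")
proof -
  let ?q = "real (ceil_sqrt d) / l"
  let ?L = "level d (\<lambda>i. x i * ?q)"
  \<comment> \<open>The pieces are assembled from the end of the program: each fact supplies the
    \<open>exit\<close> premise of the loop preceding it.\<close>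
  have out: "ensures hash_prog s (2 + (11 * d + 1)) (29, r, x) ?Q"
    if "r 0 = real d" "r 2 = 1" "r 4 = ?q" "r 5 = gap d" "r 6 = real ?L" for r
  proof -
    have "ensures hash_prog s 0 (42, r', y') ?Q"
      if "\<And>i. i < d \<Longrightarrow> y' i = of_int (cell (x i * ?q) (real ?L * gap d))" for r' y'
      using that by (intro ensures_now) (simp add: lattice_hash_def)
    note loop = output_loop[OF s this, where j = 0]
    show ?thesis
      by (rule ensures_runs[where n = 2 and t = "11 * d + 1"])
        (use that s in \<open>auto simp: run_simps hash_prog_nth intro!: loop[simplified]\<close>)
  qed
  let ?TL = "(12 * d + 8) * ?L + (12 * d + 6) + (2 + (11 * d + 1))"
  have loop: "ensures hash_prog s ?TL (10, r, x) ?Q"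
    if "r 0 = real d" "r 2 = 1" "r 4 = ?q" "r 5 = 1 / (2 * real d + 3)" "r 6 = 0" for r
    by (rule level_loop[OF s out, where m = 0, unfolded diff_zero]) (use that in \<open>simp_all add: gap_def\<close>)
  have level: "ensures hash_prog s (5 + ?TL) (5, r, x) ?Q"
    if r: "r 0 = real d" "r (Suc 0) = l" "r 2 = 1" "r 3 = real (ceil_sqrt d)" "r 6 = 0" for r
  proof -
    define U Q where "U = ?TL" and "Q = ?Q"
    have "runs hash_prog s 5 (5, r, x) (\<lambda>c. ensures hash_prog s U c Q)"
      using r s loop[folded U_def Q_def] by (simp add: run_simps hash_prog_nth)
    then show ?thesis by (intro ensures_runs[where n = 5 and t = U]) (simp_all add: U_def Q_def)
  qed
  show ?thesis
    unfolding init_config_def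
  proof (rule ensures_runs[where n = 1 and t = "4 * ceil_sqrt d + 2 + (5 + ?TL)"])
    show "runs hash_prog s 1 (0, (\<lambda>_. 0)(0 := real d, 1 := l), x)
      (\<lambda>c'. ensures hash_prog s (4 * ceil_sqrt d + 2 + (5 + ?TL)) c' ?Q)"
      using s by (auto simp: run_simps hash_prog_nth
        intro!: sqrt_loop[OF s(1) level, where k = 0, simplified])
    \<comment> \<open>With level and rounded root at most d, the linear terms are 4d + 8d + 12d +
      11d = 35d; the constants sum to 17, so 22 leaves slack.\<close>
    have "(12 * d + 8) * ?L \<le> (12 * d + 8) * d" by (intro mult_left_mono level_le) simp
    with ceil_sqrt_le[of d] show "1 + (4 * ceil_sqrt d + 2 + (5 + ?TL)) \<le> 12 * d * d + 35 * d + 22"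
      by (simp add: algebra_simps)
  qed
qed

theorem theorem5p2:
  shows "\<exists>(\<Gamma> :: nat \<Rightarrow> real)
           (\<phi> :: nat \<Rightarrow> real \<Rightarrow> (nat \<Rightarrow> real) \<Rightarrow> (nat \<Rightarrow> real))
           (P :: instr list) (time :: nat poly) (space :: nat poly).
           \<Gamma> \<in> \<Theta>(\<lambda>d. real d * sqrt (real d)) \<and>
           (\<forall>d\<ge>1. \<forall>l>0.
              is_hash d (\<Gamma> d) (d + 1) l (\<phi> d l) \<and>
              evaluates_within P d l (\<phi> d l) (poly time d) (poly space d))"
proof (intro exI conjI allI impI)
  show "(\<lambda>d. real (ceil_sqrt d) * (2 * real d + 3)) \<in> \<Theta>(\<lambda>d. real d * sqrt (real d))"
    by (rule ceil_sqrt_bigtheta)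
  fix d :: nat and l :: real
  assume d: "1 \<le> d" and l: "0 < l"
  \<comment> \<open>The scale must be positive; at d = 0 both it and \<open>\<Gamma>\<close> would
    vanish.\<close>
  have "0 < ceil_sqrt d" using ceil_sqrt_ge[of d] d by (cases "ceil_sqrt d") auto
  with l show "is_hash d (real (ceil_sqrt d) * (2 * real d + 3)) (d + 1) l
      (lattice_hash d (real (ceil_sqrt d) / l))"
    by (intro is_hash_lattice_hash sqrt_le_ceil_sqrt) auto
  \<comment> \<open>Coefficients are listed from the constant term up. Registers are below 12 and
    addresses below d, so 12 + d bounds both.\<close>
  show "evaluates_within hash_prog d l (lattice_hash d (real (ceil_sqrt d) / l))
      (poly [:22, 35, 12:] d) (poly [:12, 1:] d)"
    unfolding evaluates_within_def
  proof
    fix x :: "nat \<Rightarrow> real"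
    have "ensures hash_prog (12 + d) (12 * d * d + 35 * d + 22) (init_config d l x)
      (\<lambda>(pc, r, y). pc = 42 \<and> (\<forall>i<d. y i = lattice_hash d (real (ceil_sqrt d) / l) x i))"
      by (rule hash_prog_correct) auto
    then obtain n where "n \<le> poly [:22, 35, 12:] d"
      "runs hash_prog (poly [:12, 1:] d) n (init_config d l x)
        (\<lambda>(pc, r, y). pc = 42 \<and> (\<forall>i<d. y i = lattice_hash d (real (ceil_sqrt d) / l) x i))"
      unfolding ensures_def by (auto simp: algebra_simps)
    then show "\<exists>n\<le>poly [:22, 35, 12:] d.
        halted hash_prog ((step hash_prog ^^ n) (init_config d l x)) \<and>
        (\<forall>i<d. snd (snd ((step hash_prog ^^ n) (init_config d l x))) i =
           lattice_hash d (real (ceil_sqrt d) / l) x i) \<and>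
        (\<forall>k<n. within_space hash_prog (poly [:12, 1:] d) ((step hash_prog ^^ k) (init_config d l x)))"
      by (intro exI[of _ n]) (simp add: runs_def halted_def length_hash_prog case_prod_beta)
  qed
qed

end
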